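(* Let $x_1\geq x_2\geq x_3\geq x_4\geq x_5\geq x_6$ be real numbers such that $x_1+x_6\geq x_2+x_5\geq x_3+x_4$. Let $a_1,\dots,a_6\in\mathbb{R}$ satisfy $a_1\geq |a_2|\geq a_5\geq |a_6|$ and $a_3\geq |a_4|$, and let $g:\mathbb{R}\to\mathbb{R}$ be a function in class $\mathcal{G}_2$. Then $$\sum_{i=1}^6 a_i\prod_{\substack{1\leq j\leq 6\\ j\neq i}} g(x_i-x_j)\geq 0.$$
   Context: A function $g:\mathbb{R}\to\mathbb{R}$ is in class $\mathcal{G}$ if $g$ is either even or odd, $g(0)\geq 0$, and $g$ is monotonically nondecreasing on $[0,\infty)$. A function $g:\mathbb{R}\to\mathbb{R}$ is in class $\mathcal{G}_2$ if $g$ is in class $\mathcal{G}$ and for all $x\geq y\geq 0$ and $z\geq 0$, $$g(x)g(y+z)\geq g(y)g(x+z)\quad\text{and}\quad g(x)+g(y+z)\leq g(y)+g(x+z).$$ *)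

theory Defs
  imports "HOL-Analysis.Analysis"
begin

definition class_G :: "(real \<Rightarrow> real) set" where
  "class_G = {g. ((\<forall>t. g (- t) = g t) \<or> (\<forall>t. g (- t) = - g t)) \<and>
                 g 0 \<ge> 0 \<and> mono_on {0..} g}"

definition class_G2 :: "(real \<Rightarrow> real) set" where
  "class_G2 = {g \<in> class_G. \<forall>x y z. x \<ge> y \<and> y \<ge> 0 \<and> z \<ge> 0 \<longrightarrow>
                 g x * g (y + z) \<ge> g y * g (x + z) \<and>
                 g x + g (y + z) \<le> g y + g (x + z)}"

end

theory Submission
  imports Defs
begin

text \<open>Write \<open>P\<^sub>i\<close> for the product of the values \<open>g \<bar>x\<^sub>i - x\<^sub>j\<bar>\<close> over \<open>j \<noteq> i\<close>. Parity only
  affects the signs of the terms with even index, so the worst case is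
  \<open>(a\<^sub>1 P\<^sub>1 - \<bar>a\<^sub>2\<bar> P\<^sub>2 + a\<^sub>5 P\<^sub>5 - \<bar>a\<^sub>6\<bar> P\<^sub>6) + (a\<^sub>3 P\<^sub>3 - \<bar>a\<^sub>4\<bar> P\<^sub>4)\<close>. The hypotheses on \<open>a\<close> reduce its
  nonnegativity to \<open>P\<^sub>1 \<ge> P\<^sub>2\<close> (monotonicity), \<open>P\<^sub>3 \<ge> P\<^sub>4\<close> (the multiplicative inequality, applied
  to the pairs 1, 6 and 2, 5) and \<open>P\<^sub>1 + P\<^sub>5 \<ge> P\<^sub>2 + P\<^sub>6\<close>. For the last, the common factors are
  peeled off one at a time, down to the additive inequality.\<close>

lemma class_G2_nonneg:
  assumes "g \<in> class_G2" "0 \<le> t"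
  shows "0 \<le> g t"
  using assms unfolding class_G2_def class_G_def mono_on_def
  by (auto intro: order_trans)

lemma class_G2_mono:
  assumes "g \<in> class_G2" "0 \<le> s" "s \<le> t"
  shows "g s \<le> g t"
  using assms unfolding class_G2_def class_G_def mono_on_def by auto

lemma class_G2_mult:
  assumes "g \<in> class_G2" "0 \<le> y" "y \<le> x" "0 \<le> z"
  shows "g y * g (x + z) \<le> g x * g (y + z)"
  using assms unfolding class_G2_def by blast

lemma class_G2_add:
  assumes "g \<in> class_G2" "0 \<le> y" "y \<le> x" "0 \<le> z"
  shows "g x + g (y + z) \<le> g y + g (x + z)"
  using assms unfolding class_G2_def by blast

text \<open>A single sign \<open>s\<close> lets the even and odd cases be treated together.\<close>

lemma class_G2_parity:
  assumes "g \<in> class_G2"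
  obtains s :: real where "s = 1 \<or> s = -1" "\<And>t. g (- t) = s * g t"
proof -
  consider "\<forall>t. g (- t) = g t" | "\<forall>t. g (- t) = - g t"
    using assms unfolding class_G2_def class_G_def by blast
  then show thesis
    by cases (use that[of 1] that[of "-1"] in auto)
qed

text \<open>By \<open>class_G2_add\<close>, increments over a fixed step grow with the base point;
  lengthening the step at \<open>x\<close> from \<open>z\<close> to \<open>w\<close> only helps, by
  monotonicity.\<close>

lemma class_G2_increment:
  assumes "g \<in> class_G2" "0 \<le> y" "y \<le> x" "0 \<le> z" "z \<le> w"
  shows "g (y + z) - g y \<le> g (x + w) - g x"
  using class_G2_add[OF assms(1-4)] class_G2_mono[OF assms(1), of "x + z" "x + w"] assms
  by linarith

text \<open>Split \<open>D * D' - d * d' = (D - d) * D' + d * (D' - d')\<close>, likewise on the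
  right, and compare summand by summand.\<close>

lemma product_increment_le:
  fixes A B C D :: "'a::linordered_idom"
  assumes "D - d \<le> A - a" "D' - d' \<le> A' - a'"
    and "0 \<le> d" "d \<le> a" "d \<le> D" "0 \<le> D'" "D' \<le> A'" "d' \<le> D'"
  shows "D * D' - d * d' \<le> A * A' - a * a'"
proof -
  have "(D - d) * D' \<le> (A - a) * A'" "d * (D' - d') \<le> a * (A' - a')"
    using assms by (auto intro!: mult_mono)
  then show ?thesis
    by (simp add: algebra_simps)
qed

text \<open>Since \<open>u\<close> may be negative, \<open>mult_mono\<close> does not apply; the
  bound passes through \<open>p * v\<close>.\<close>

lemma scaled_le:
  fixes p q u v :: "'a::linordered_idom"
  assumes "u \<le> v" "0 \<le> v" "0 \<le> p" "p \<le> q"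
  shows "p * u \<le> q * v"
  using mult_left_mono[OF assms(1,3)] mult_right_mono[OF assms(4,2)] by linarith

lemma signed_terms_nonneg:
  fixes s :: real
  assumes s: "s = 1 \<or> s = -1"
    and P: "P2 \<le> P1" "P4 \<le> P3" "P2 + P6 \<le> P1 + P5"
    and P_nonneg: "0 \<le> P1" "0 \<le> P2" "0 \<le> P4" "0 \<le> P3" "0 \<le> P6"
    and a: "\<bar>a2\<bar> \<le> a1" "a5 \<le> \<bar>a2\<bar>" "\<bar>a6\<bar> \<le> a5" "\<bar>a4\<bar> \<le> a3"
  shows "0 \<le> a1 * P1 + s * a2 * P2 + a3 * P3 + s * a4 * P4 + a5 * P5 + s * a6 * P6"
proof -
  have signed: "- (\<bar>c\<bar> * P) \<le> s * c * P" if "0 \<le> P" for c P :: real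
  proof -
    have "- \<bar>c\<bar> \<le> s * c" using s by auto
    from mult_right_mono[OF this that] show ?thesis by simp
  qed
  have "\<bar>a2\<bar> * P1 \<le> a1 * P1" "\<bar>a6\<bar> * P6 \<le> a5 * P6" "\<bar>a4\<bar> * P4 \<le> a3 * P3"
    using a P P_nonneg by (auto intro!: mult_mono)
  \<comment> \<open>Summation by parts: these two add up to
    \<open>\<bar>a2\<bar> * (P1 - P2) + a5 * (P5 - P6)\<close>.\<close>
  moreover have "0 \<le> (\<bar>a2\<bar> - a5) * (P1 - P2)" "0 \<le> a5 * (P1 - P2 + P5 - P6)"
    using a P by auto
  ultimately show ?thesis
    using signed[of P2 a2] signed[of P4 a4] signed[of P6 a6] P_nonneg
    by (simp add: algebra_simps)
qed

theorem theorem4: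
  fixes x a :: "nat \<Rightarrow> real" and g :: "real \<Rightarrow> real"
  assumes "x 1 \<ge> x 2" and "x 2 \<ge> x 3" and "x 3 \<ge> x 4" and "x 4 \<ge> x 5" and "x 5 \<ge> x 6"
    and "x 1 + x 6 \<ge> x 2 + x 5" and "x 2 + x 5 \<ge> x 3 + x 4"
    and "a 1 \<ge> \<bar>a 2\<bar>" and "\<bar>a 2\<bar> \<ge> a 5" and "a 5 \<ge> \<bar>a 6\<bar>"
    and "a 3 \<ge> \<bar>a 4\<bar>"
    and "g \<in> class_G2"
  shows "(\<Sum>i = 1..6. a i * (\<Prod>j \<in> {1..6} - {i}. g (x i - x j))) \<ge> 0"
proof -
  note x_le = assms(1-7)
  note mono = class_G2_mono[OF assms(12)]
  define G where "G i j = g (x i - x j)" for i j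
  obtain s where s: "s = 1 \<or> s = -1" and "\<And>t. g (- t) = s * g t"
    using class_G2_parity[OF assms(12)] by metis
  then have swap: "G j i = s * G i j" for i j
    unfolding G_def by (metis minus_diff_eq)
  have ss: "s * s = 1" "\<And>t. s * (s * t) = t" using s by auto
  have nonneg: "0 \<le> G 1 2" "0 \<le> G 1 3" "0 \<le> G 1 4" "0 \<le> G 1 5" "0 \<le> G 1 6"
    "0 \<le> G 2 3" "0 \<le> G 2 4" "0 \<le> G 2 5" "0 \<le> G 2 6" "0 \<le> G 3 4" "0 \<le> G 3 5" "0 \<le> G 3 6"
    "0 \<le> G 4 5" "0 \<le> G 4 6" "0 \<le> G 5 6"
    unfolding G_def using x_le by (auto intro!: class_G2_nonneg[OF assms(12)])
  have le: "G 2 3 \<le> G 1 3" "G 2 4 \<le> G 1 4" "G 2 5 \<le> G 1 5" "G 2 6 \<le> G 1 6" "G 5 6 \<le> G 1 2"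
    "G 3 6 \<le> G 1 4" "G 4 6 \<le> G 1 3" "G 2 6 \<le> G 1 5" "G 2 5 \<le> G 1 6" "G 4 5 \<le> G 2 3"
    "G 4 5 \<le> G 4 6" "G 3 5 \<le> G 3 6"
    unfolding G_def using x_le by (auto intro!: mono)
  define P1 where "P1 = G 1 2 * G 1 3 * G 1 4 * G 1 5 * G 1 6"
  define P2 where "P2 = G 1 2 * G 2 3 * G 2 4 * G 2 5 * G 2 6"
  define P3 where "P3 = G 1 3 * G 2 3 * G 3 4 * G 3 5 * G 3 6"
  define P4 where "P4 = G 1 4 * G 2 4 * G 3 4 * G 4 5 * G 4 6"
  define P5 where "P5 = G 1 5 * G 2 5 * G 3 5 * G 4 5 * G 5 6"
  define P6 where "P6 = G 1 6 * G 2 6 * G 3 6 * G 4 6 * G 5 6"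
  note P_defs = P1_def P2_def P3_def P4_def P5_def P6_def
  have P_nonneg: "0 \<le> P1" "0 \<le> P2" "0 \<le> P3" "0 \<le> P4" "0 \<le> P6"
    using nonneg by (simp_all add: P_defs)
  have "P2 \<le> P1"
    unfolding P_defs using nonneg le by (intro mult_mono mult_nonneg_nonneg) auto
  moreover have "P4 \<le> P3"
  proof -
    \<comment> \<open>Shifting by \<open>x 3 - x 4\<close> turns the gaps \<open>x 1 - x 3\<close>,
      \<open>x 4 - x 6\<close> into \<open>x 1 - x 4\<close>, \<open>x 3 - x 6\<close>; similarly
      with 2, 5 in place of 1, 6.\<close>
    have "G 4 6 * G 1 4 \<le> G 1 3 * G 3 6" "G 4 5 * G 2 4 \<le> G 2 3 * G 3 5"
      unfolding G_def
      using class_G2_mult[OF assms(12), of "x 4 - x 6" "x 1 - x 3" "x 3 - x 4"]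
        class_G2_mult[OF assms(12), of "x 4 - x 5" "x 2 - x 3" "x 3 - x 4"] x_le
      by simp_all
    then have "(G 4 6 * G 1 4) * (G 4 5 * G 2 4) * G 3 4 \<le> (G 1 3 * G 3 6) * (G 2 3 * G 3 5) * G 3 4"
      using nonneg by (intro mult_right_mono mult_mono[of "G 4 6 * G 1 4"] mult_nonneg_nonneg) auto
    then show ?thesis
      by (simp add: P_defs mult_ac)
  qed
  moreover have "P2 + P6 \<le> P1 + P5"
  proof -
    \<comment> \<open>Base points compare by \<open>x 3 + x 4 \<le> x 2 + x 5\<close>, step lengths
      by \<open>x 2 + x 5 \<le> x 1 + x 6\<close>.\<close>
    have "G 4 6 - G 4 5 \<le> G 1 3 - G 2 3" "G 3 6 - G 3 5 \<le> G 1 4 - G 2 4"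
      unfolding G_def
      using class_G2_increment[OF assms(12), of "x 4 - x 5" "x 2 - x 3" "x 5 - x 6" "x 1 - x 2"]
        class_G2_increment[OF assms(12), of "x 3 - x 5" "x 2 - x 4" "x 5 - x 6" "x 1 - x 2"] x_le
      by simp_all
    then have "G 4 6 * G 3 6 - G 4 5 * G 3 5 \<le> G 1 3 * G 1 4 - G 2 3 * G 2 4"
      using nonneg le by (intro product_increment_le) auto
    \<comment> \<open>\<open>G 2 6\<close> divides \<open>P2\<close> and \<open>P6\<close>,
      \<open>G 1 5\<close> divides \<open>P1\<close> and \<open>P5\<close>. After regrouping by
      shared factor, the same is done with \<open>G 2 5\<close>, \<open>G 1 6\<close> and then with
      \<open>G 5 6\<close>, \<open>G 1 2\<close>.\<close>
    then have "G 2 6 * (G 2 3 * G 2 4 + G 4 6 * G 3 6) \<le> G 1 5 * (G 1 3 * G 1 4 + G 4 5 * G 3 5)"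
      using nonneg le by (intro mult_mono) auto
    then have "G 2 3 * G 2 4 * G 2 6 - G 1 5 * G 3 5 * G 4 5
        \<le> G 1 3 * G 1 4 * G 1 5 - G 2 6 * G 3 6 * G 4 6"
      by (simp add: algebra_simps)
    \<comment> \<open>The larger difference must be nonnegative for
      \<open>scaled_le\<close>.\<close>
    moreover have "G 4 6 * G 3 6 * G 2 6 \<le> G 1 3 * G 1 4 * G 1 5"
      using nonneg le by (intro mult_mono mult_nonneg_nonneg) auto
    ultimately have "G 2 5 * (G 2 3 * G 2 4 * G 2 6 - G 1 5 * G 3 5 * G 4 5)
        \<le> G 1 6 * (G 1 3 * G 1 4 * G 1 5 - G 2 6 * G 3 6 * G 4 6)"
      using nonneg le by (intro scaled_le) (auto simp: mult_ac)
    then have "G 1 6 * G 2 6 * G 3 6 * G 4 6 - G 1 5 * G 2 5 * G 3 5 * G 4 5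
        \<le> G 1 3 * G 1 4 * G 1 5 * G 1 6 - G 2 3 * G 2 4 * G 2 5 * G 2 6"
      by (simp add: algebra_simps)
    moreover have "G 2 3 * G 2 4 * G 2 5 * G 2 6 \<le> G 1 3 * G 1 4 * G 1 5 * G 1 6"
      using nonneg le by (intro mult_mono mult_nonneg_nonneg) auto
    ultimately have "G 5 6 * (G 1 6 * G 2 6 * G 3 6 * G 4 6 - G 1 5 * G 2 5 * G 3 5 * G 4 5)
        \<le> G 1 2 * (G 1 3 * G 1 4 * G 1 5 * G 1 6 - G 2 3 * G 2 4 * G 2 5 * G 2 6)"
      using nonneg le by (intro scaled_le) auto
    then show ?thesis
      by (simp add: P_defs algebra_simps)
  qed
  moreover have "(\<Sum>i = 1..6. a i * (\<Prod>j \<in> {1..6} - {i}. g (x i - x j)))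
      = a 1 * P1 + s * a 2 * P2 + a 3 * P3 + s * a 4 * P4 + a 5 * P5 + s * a 6 * P6"
  proof -
    have I: "{1..6::nat} = {1, 2, 3, 4, 5, 6}"
      by auto
    \<comment> \<open>Term \<open>i\<close> has \<open>i - 1\<close> factors with
      \<open>j < i\<close>, each giving one \<open>s\<close> when swapped; as
      \<open>s * s = 1\<close>, a sign survives only for even \<open>i\<close>.\<close>
    show ?thesis
      unfolding I G_def[symmetric] P_defs
      by (simp add: insert_Diff_if swap[of 2 1] swap[of 3 1] swap[of 3 2] swap[of 4 1]
          swap[of 4 2] swap[of 4 3] swap[of 5 1] swap[of 5 2] swap[of 5 3] swap[of 5 4]
          swap[of 6 1] swap[of 6 2] swap[of 6 3] swap[of 6 4] swap[of 6 5] mult_ac ss del: One_nat_def)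
  qed
  ultimately show ?thesis
    using signed_terms_nonneg[OF s _ _ _ _ _ _ _ _ assms(8-11)] P_nonneg by simp
qed

end
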